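(* Let $G$ be a graph, and suppose there is an edge $e$ of $G$ that attains the maximum label in every magic labeling of $G$ of index $2$ (that is, $L(e) = \max_{e' \in E} L(e')$ for every magic labeling $L$ of $G$ of index $2$). Then $M_G(k)$ is a quasipolynomial of quasiperiod at most $2$. If $G$ is furthermore bipartite, then $M_G(k)$ is a polynomial in $k$.
   Context: A graph $G=(V,E)$ is finite, undirected, without multiple edges (but possibly with loops). For $L\in\mathbb{R}^E$ and $v\in V$ put $s_L(v) = \sum_{e \in E,\, e \ni v} L(e)$ (a loop at $v$ contributes its label once). A magic labeling of $G$ is a function $L : E \to \mathbb{Z}_{\ge 0}$ such that $s_L(v)$ takes the same value for all $v \in V$; this common value is the index of $L$. For $k \in \mathbb{Z}_{\ge 0}$, $M_G(k)$ denotes the number of magic labelings $L$ of $G$ with $L(e) \le k$ for all $e \in E$. A function $F : \mathbb{Z}_{\ge 0} \to \mathbb{C}$ is a quasipolynomial if there exist an integer $s \ge 1$ and polynomials $\phi_1,\dots,\phi_s \in \mathbb{C}[x]$ such that $F(t) = \phi_r(t)$ whenever $t \equiv r \pmod s$; such an $s$ is called a quasiperiod of $F$. *)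

theory Defs
  imports
    Complex_Main
    "HOL-Library.FuncSet"
    "HOL-Number_Theory.Cong"
    "HOL-Computational_Algebra.Polynomial"
begin

text \<open>
  An edge is the set of its endpoints, so multiple edges are excluded, and a loop at \<open>v\<close>
  is the singleton \<open>{v}\<close> (the case \<open>u = v\<close> below).
\<close>

definition graph :: "'v set \<Rightarrow> 'v set set \<Rightarrow> bool" where
  "graph V E \<longleftrightarrow> finite V \<and> E \<subseteq> {{u, v} | u v. u \<in> V \<and> v \<in> V}"

definition bipartite :: "'v set \<Rightarrow> 'v set set \<Rightarrow> bool" where
  "bipartite V E \<longleftrightarrow>
     (\<exists>A B. A \<union> B = V \<and> A \<inter> B = {} \<and> (\<forall>e\<in>E. \<exists>a\<in>A. \<exists>b\<in>B. e = {a, b}))"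

text \<open>Since edges are sets, a loop at \<open>v\<close> contributes its label exactly once.\<close>

definition vertex_sum :: "'v set set \<Rightarrow> ('v set \<Rightarrow> 'a::comm_monoid_add) \<Rightarrow> 'v \<Rightarrow> 'a" where
  "vertex_sum E L v = (\<Sum>e | e \<in> E \<and> v \<in> e. L e)"

text \<open>
  A function on \<open>E\<close> is represented by a total function that is \<open>undefined\<close> outside \<open>E\<close>,
  so that distinct elements of the set of labelings differ on \<open>E\<close> and counting is meaningful.
\<close>

definition magic_labeling_of_index ::
    "'v set \<Rightarrow> 'v set set \<Rightarrow> nat \<Rightarrow> ('v set \<Rightarrow> nat) \<Rightarrow> bool" where
  "magic_labeling_of_index V E r L \<longleftrightarrow>
     L \<in> extensional E \<and> (\<forall>v\<in>V. vertex_sum E L v = r)"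

definition magic_labeling :: "'v set \<Rightarrow> 'v set set \<Rightarrow> ('v set \<Rightarrow> nat) \<Rightarrow> bool" where
  "magic_labeling V E L \<longleftrightarrow> (\<exists>r. magic_labeling_of_index V E r L)"

definition magic_count :: "'v set \<Rightarrow> 'v set set \<Rightarrow> nat \<Rightarrow> nat" where
  "magic_count V E k = card {L. magic_labeling V E L \<and> (\<forall>e\<in>E. L e \<le> k)}"

definition has_quasiperiod :: "(nat \<Rightarrow> complex) \<Rightarrow> nat \<Rightarrow> bool" where
  "has_quasiperiod F s \<longleftrightarrow>
     s \<ge> 1 \<and> (\<exists>\<phi> :: nat \<Rightarrow> complex poly.
       \<forall>r\<in>{1..s}. \<forall>t. [t = r] (mod s) \<longrightarrow> F t = poly (\<phi> r) (of_nat t))"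

definition quasipolynomial :: "(nat \<Rightarrow> complex) \<Rightarrow> bool" where
  "quasipolynomial F \<longleftrightarrow> (\<exists>s. has_quasiperiod F s)"

definition polynomial_function :: "(nat \<Rightarrow> complex) \<Rightarrow> bool" where
  "polynomial_function F \<longleftrightarrow> (\<exists>p :: complex poly. \<forall>t. F t = poly p (of_nat t))"

end

theory Submission imports Defs begin

text \<open>
  A real magic labeling is a symmetric matrix with constant line sum, so by Hall's theorem every
  nonzero one contains in its support a labeling of index 2 (the symmetrisation of a permutation
  matrix), or of index 1 if the graph is bipartite. Subtracting multiples of such labelings until
  nothing is left shows that \<open>e\<close> carries the maximum of every magic labeling, so
  \<^term>\<open>magic_count V E k\<close> counts the labelings \<open>L\<close> with \<open>L e \<le> k\<close>. These are the integer points of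
  a cone all of whose nonzero faces contain an integer vector \<open>w\<close> with \<open>w e = d\<close>, where \<open>d = 2\<close>, or
  \<open>d = 1\<close> in the bipartite case.

  Call a point of the cone reduced if it is not \<open>\<ge> w\<close>. A reduced point is uniquely \<open>y + c w\<close> with
  \<open>0 \<le> c < 1\<close> and \<open>y\<close> vanishing somewhere on the support of \<open>w\<close>; here \<open>y\<close> runs through points of
  lower-dimensional faces in finitely many cosets of the integer lattice. Subtracting \<open>w\<close> from the
  nonreduced points expresses the count at \<open>k\<close> as the count at \<open>k - d\<close> plus counts for proper
  faces, and the result follows by induction on the dimension. Allowing arbitrary real cosets and
  real bounds \<open>k\<close> is what makes this induction work.
\<close>

section \<open>Polynomial functions on arithmetic progressions\<close>

text \<open>By the binomial theorem \<open>(x + 1) ^ Suc m - x ^ Suc m\<close> is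
  \<open>Suc m * x ^ m\<close> plus lower powers, whose antidifferences come from the induction
  hypothesis; solving for \<open>x ^ m\<close> gives \<open>?R\<close>.\<close>

lemma poly_antidifference_monomial:
  "\<exists>Q :: 'a::field_char_0 poly. \<forall>x. poly Q (x + 1) - poly Q x = x ^ m"
proof (induction m rule: less_induct)
  case (less m)
  then obtain Q :: "nat \<Rightarrow> 'a poly"
    where Q: "\<And>i x. i < m \<Longrightarrow> poly (Q i) (x + 1) - poly (Q i) x = x ^ i"
    by metis
  let ?R = "smult (1 / of_nat (Suc m))
    (monom 1 (Suc m) - (\<Sum>i<m. smult (of_nat (Suc m choose i)) (Q i)))"
  have "poly ?R (x + 1) - poly ?R x = x ^ m" for x
  proof -
    have "(x + 1) ^ Suc m = (\<Sum>i\<le>Suc m. of_nat (Suc m choose i) * x ^ i)"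
      using binomial_ring[of x 1 "Suc m"] by simp
    also have "\<dots> = (\<Sum>i<m. of_nat (Suc m choose i) * x ^ i)
        + of_nat (Suc m) * x ^ m + x ^ Suc m"
      by (simp add: lessThan_Suc_atMost [symmetric] algebra_simps)
    finally have 1: "(x + 1) ^ Suc m - x ^ Suc m
        = (\<Sum>i<m. of_nat (Suc m choose i) * x ^ i) + of_nat (Suc m) * x ^ m"
      by simp
    have 2: "(\<Sum>i<m. of_nat (Suc m choose i) * poly (Q i) (x + 1))
        - (\<Sum>i<m. of_nat (Suc m choose i) * poly (Q i) x)
        = (\<Sum>i<m. of_nat (Suc m choose i) * x ^ i)"
      unfolding sum_subtractf [symmetric] right_diff_distrib [symmetric]
      by (intro sum.cong) (simp_all add: Q)
    have "poly ?R (x + 1) - poly ?R x = 1 / of_nat (Suc m) *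
      (((x + 1) ^ Suc m - x ^ Suc m) - ((\<Sum>i<m. of_nat (Suc m choose i) * poly (Q i) (x + 1))
        - (\<Sum>i<m. of_nat (Suc m choose i) * poly (Q i) x)))"
      unfolding poly_smult poly_diff poly_sum poly_monom right_diff_distrib mult_1 by simp
    also have "\<dots> = x ^ m"
      unfolding 1 2 by (simp del: of_nat_Suc)
    finally show ?thesis .
  qed
  then show ?case by blast
qed

lemma poly_sum_lessThan:
  fixes q :: "'a::field_char_0 poly"
  obtains Q where "\<And>n. (\<Sum>j<n. poly q (of_nat j)) = poly Q (of_nat n)"
proof -
  obtain M :: "nat \<Rightarrow> 'a poly" where M: "\<And>i x. poly (M i) (x + 1) - poly (M i) x = x ^ i"
    using poly_antidifference_monomial by metis
  define A where "A = (\<Sum>i\<le>degree q. smult (coeff q i) (M i))"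
  have A: "poly A (x + 1) - poly A x = poly q x" for x
    unfolding A_def poly_sum sum_subtractf [symmetric] poly_smult right_diff_distrib [symmetric] M
    by (simp add: poly_altdef)
  \<comment> \<open>The constant \<open>poly A 0\<close> is what telescoping leaves at the lower
    end.\<close>
  have "(\<Sum>j<n. poly q (of_nat j)) = poly (A - [:poly A 0:]) (of_nat n)" for n
    using sum_lessThan_telescope[of "\<lambda>j. poly A (of_nat j)" n] A
    by (simp add: algebra_simps flip: A)
  with that show thesis by blast
qed

text \<open>The starting points \<open>r\<close> are real because the induction on faces shifts
  bounds by real multiples of \<open>d\<close>. The polynomial may depend on \<open>r\<close> and is
  taken in the step number \<open>n\<close>, not in the argument of \<open>f\<close>.\<close>

definition polynomial_on_progressions :: "nat \<Rightarrow> (real \<Rightarrow> complex) \<Rightarrow> bool" where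
  "polynomial_on_progressions d f \<longleftrightarrow>
     (\<forall>r. 0 \<le> r \<and> r < real d \<longrightarrow>
       (\<exists>q. \<forall>n. f (r + real d * real n) = poly q (of_nat n)))"

lemma polynomial_on_progressions_add:
  assumes "polynomial_on_progressions d f" "polynomial_on_progressions d g"
  shows "polynomial_on_progressions d (\<lambda>k. f k + g k)"
  unfolding polynomial_on_progressions_def
proof (intro allI impI)
  fix r :: real assume "0 \<le> r \<and> r < d"
  then obtain p q where "\<And>n. f (r + real d * real n) = poly p (of_nat n)"
      "\<And>n. g (r + real d * real n) = poly q (of_nat n)"
    using assms unfolding polynomial_on_progressions_def by blast
  then have "f (r + real d * real n) + g (r + real d * real n) = poly (p + q) (of_nat n)" for n
    by simp
  then show "\<exists>q. \<forall>n. f (r + real d * real n) + g (r + real d * real n) = poly q (of_nat n)"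
    by blast
qed

lemma polynomial_on_progressions_diff:
  assumes "polynomial_on_progressions d f" "polynomial_on_progressions d g"
  shows "polynomial_on_progressions d (\<lambda>k. f k - g k)"
  unfolding polynomial_on_progressions_def
proof (intro allI impI)
  fix r :: real assume "0 \<le> r \<and> r < d"
  then obtain p q where "\<And>n. f (r + real d * real n) = poly p (of_nat n)"
      "\<And>n. g (r + real d * real n) = poly q (of_nat n)"
    using assms unfolding polynomial_on_progressions_def by blast
  then have "f (r + real d * real n) - g (r + real d * real n) = poly (p - q) (of_nat n)" for n
    by simp
  then show "\<exists>q. \<forall>n. f (r + real d * real n) - g (r + real d * real n) = poly q (of_nat n)"
    by blast
qed

text \<open>Unrolling \<open>rec\<close> from \<open>r + d * n\<close> down to a negative argument
  writes \<open>f\<close> as a sum of values of the \<open>g c\<close> along progressions of step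
  \<open>d\<close>, and sums of polynomials are polynomial. The shift by \<open>d * c\<close> may
  push the starting point out of \<open>[0, d)\<close>, whence the case split in the proof.\<close>

lemma polynomial_on_progressions_recurrence:
  fixes C :: "real set" and d :: nat
  assumes d: "d > 0" and "finite C" and C: "\<And>c. c \<in> C \<Longrightarrow> 0 \<le> c \<and> c < 1"
    and f_neg: "\<And>k. k < 0 \<Longrightarrow> f k = 0"
    and g_neg: "\<And>c k. k < 0 \<Longrightarrow> g c k = 0"
    and g: "\<And>c. c \<in> C \<Longrightarrow> polynomial_on_progressions d (g c)"
    and rec: "\<And>k. f k = f (k - real d) + (\<Sum>c\<in>C. g c (k - real d * c))"
  shows "polynomial_on_progressions d f"
  unfolding polynomial_on_progressions_def
proof (intro allI impI, elim conjE)
  fix r :: real assume r: "0 \<le> r" "r < d"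
  have f_eq: "f (r + d * real n) = (\<Sum>c\<in>C. \<Sum>j<Suc n. g c (r - d * c + d * real j))" for n
  proof (induction n)
    case 0
    have "f (r - d) = 0" using r by (intro f_neg) simp
    then show ?case using rec[of r] by (simp add: algebra_simps)
  next
    case (Suc n)
    have "f (r + d * real (Suc n)) = f (r + d * real n) + (\<Sum>c\<in>C. g c (r - d * c + d * real (Suc n)))"
      using rec[of "r + d * real (Suc n)"] by (simp add: algebra_simps)
    also have "\<dots> = (\<Sum>c\<in>C. \<Sum>j<Suc (Suc n). g c (r - d * c + d * real j))"
      unfolding Suc.IH sum.distrib [symmetric] by (intro sum.cong) auto
    finally show ?case .
  qed
  have "\<exists>q. \<forall>n::nat. (\<Sum>j<Suc n. g c (r - d * c + d * real j)) = poly q (of_nat n)" if cC: "c \<in> C" for c :: real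
  proof (cases "d * c \<le> r")
    case True
    moreover have "r - d * c < d" using r C[OF cC] mult_nonneg_nonneg[of "real d" c] by linarith
    ultimately obtain q where q: "\<And>n. g c (r - d * c + d * real n) = poly q (of_nat n)"
      using g[OF cC] unfolding polynomial_on_progressions_def by force
    obtain Q where Q: "\<And>n. (\<Sum>j<n. poly q (of_nat j)) = poly Q (of_nat n)"
      using poly_sum_lessThan[of q] by blast
    show ?thesis
      \<comment> \<open>There are \<open>n + 1\<close> summands, so \<open>Q\<close> is taken at
        \<open>n + 1\<close>.\<close>
      unfolding q Q by (intro exI[of _ "pcompose Q [:1, 1:]"]) (simp add: poly_pcompose)
  next
    case False
    have "real d * c < real d * 1" using C[OF cC] d by (intro mult_strict_left_mono) auto
    then have "0 \<le> r - d * c + d" "r - d * c + d < d" using r False by linarith+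
    then obtain q where q: "\<And>n. g c (r - d * c + d + d * real n) = poly q (of_nat n)"
      using g[OF cC] unfolding polynomial_on_progressions_def by blast
    obtain Q where Q: "\<And>n. (\<Sum>j<n. poly q (of_nat j)) = poly Q (of_nat n)"
      using poly_sum_lessThan[of q] by blast
    \<comment> \<open>The term \<open>j = 0\<close> has a negative argument and vanishes; the other
      \<open>n\<close> terms form a progression that starts in \<open>[0, d)\<close>.\<close>
    have "(\<Sum>j<Suc n. g c (r - d * c + d * real j)) = (\<Sum>j<n. poly q (of_nat j))" for n
      unfolding sum.lessThan_Suc_shift using False
      by (auto simp: g_neg q [symmetric] algebra_simps)
    then show ?thesis unfolding Q by metis
  qed
  then have "\<forall>c\<in>C. \<exists>q. \<forall>n. (\<Sum>j<Suc n. g c (r - d * c + d * real j)) = poly q (of_nat n)"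
    by blast
  from bchoice[OF this] obtain q
    where q: "\<forall>c\<in>C. \<forall>n. (\<Sum>j<Suc n. g c (r - d * c + d * real j)) = poly (q c) (of_nat n)" ..
  have "f (r + d * real n) = poly (\<Sum>c\<in>C. q c) (of_nat n)" for n
    unfolding f_eq poly_sum using q by (intro sum.cong refl) blast
  then show "\<exists>q. \<forall>n. f (r + d * real n) = poly q (of_nat n)" by blast
qed

section \<open>Counting in cones whose rays peak at a fixed coordinate\<close>

lemma finite_coset_interval: "finite {t :: real. 0 \<le> t \<and> t \<le> k \<and> t - a \<in> \<int>}"
proof -
  have "{t. 0 \<le> t \<and> t \<le> k \<and> t - a \<in> \<int>} \<subseteq> (\<lambda>z. a + of_int z) ` {\<lfloor>- a\<rfloor>..\<lceil>k - a\<rceil>}"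
  proof
    fix t assume "t \<in> {t. 0 \<le> t \<and> t \<le> k \<and> t - a \<in> \<int>}"
    then obtain z where "t = a + of_int z" "0 \<le> t" "t \<le> k"
      by (auto elim!: Ints_cases simp: algebra_simps)
    then show "t \<in> (\<lambda>z. a + of_int z) ` {\<lfloor>- a\<rfloor>..\<lceil>k - a\<rceil>}"
      by (intro image_eqI[of _ _ z]) (auto simp: floor_le_iff le_ceiling_iff)
  qed
  then show ?thesis by (rule finite_subset) simp
qed

text \<open>\<open>W\<close>, if nonempty, is a linear space; the cone is its nonnegative part, with
  faces cut out by setting coordinates to zero. \<open>peak\<close> says that the smallest face
  through any nonzero point contains an integer vector whose maximum is attained at \<open>e\<close>
  and equals \<open>d\<close>; the same \<open>d\<close> for all faces gives all recurrences the
  same step.\<close>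

locale peaked_cone =
  fixes E :: "'a set" and W :: "('a \<Rightarrow> real) set" and e :: 'a and d :: nat
  assumes finite_E: "finite E" and e_in: "e \<in> E" and d_pos: "d > 0"
    and W_outside: "x \<in> W \<Longrightarrow> i \<notin> E \<Longrightarrow> x i = 0"
    and W_lin: "x \<in> W \<Longrightarrow> y \<in> W \<Longrightarrow> (\<lambda>i. x i + c * y i) \<in> W"
    and peak: "x \<in> W \<Longrightarrow> \<forall>i. 0 \<le> x i \<Longrightarrow> x j \<noteq> 0 \<Longrightarrow>
      \<exists>w :: 'a \<Rightarrow> nat. (\<lambda>i. real (w i)) \<in> W \<and> w e = d \<and> (\<forall>i. w i \<le> d)
        \<and> (\<forall>i. w i \<noteq> 0 \<longrightarrow> x i \<noteq> 0)"
begin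

text \<open>Greedy decomposition: subtracting the largest multiple of \<open>w\<close> that keeps
  \<open>x\<close> nonnegative makes a new coordinate vanish, so induction on the support applies to
  the rest; \<open>e\<close> carries the maximum of both summands.\<close>

lemma le_peak:
  assumes "x \<in> W" "\<forall>i. 0 \<le> x i"
  shows "x i \<le> x e"
  using assms
proof (induction "card {i \<in> E. x i \<noteq> 0}" arbitrary: x rule: less_induct)
  case less
  show ?case
  proof (cases "\<exists>j. x j \<noteq> 0")
    case True
    then obtain w :: "'a \<Rightarrow> nat" where w: "(\<lambda>i. real (w i)) \<in> W" "w e = d" "\<And>i. w i \<le> d"
        "\<And>i. w i \<noteq> 0 \<Longrightarrow> x i \<noteq> 0"
      using peak less.prems by blast
    have w_out: "w i = 0" if "i \<notin> E" for i using W_outside[OF w(1) that] by simp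
    define S where "S = {i \<in> E. w i \<noteq> 0}"
    \<comment> \<open>Ratio test: the largest \<open>c\<close> with \<open>c * w \<le> x\<close>,
      attained at some \<open>s\<close> where the remainder is zero.\<close>
    define c where "c = Min ((\<lambda>i. x i / w i) ` S)"
    have S: "finite S" "e \<in> S" using finite_E e_in w(2) d_pos by (auto simp: S_def)
    have "c \<in> (\<lambda>i. x i / w i) ` S" unfolding c_def using S by (intro Min_in) auto
    then obtain s where s: "s \<in> S" "c = x s / w s" by blast
    have c_nonneg: "c \<ge> 0" using s less.prems(2) by auto
    have c_le: "c * real (w i) \<le> x i" for i
    proof (cases "i \<in> S")
      case True
      then have "c \<le> x i / w i" unfolding c_def using S by (intro Min_le) auto
      then show ?thesis using True by (auto simp: S_def field_simps)
    next
      case False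
      then have "w i = 0" using w_out by (auto simp: S_def)
      then show ?thesis using less.prems(2) by simp
    qed
    define y where "y = (\<lambda>i. x i + (- c) * w i)"
    have "y s = 0" using s by (simp add: y_def S_def)
    moreover have "x s \<noteq> 0" "s \<in> E" using s w(4) by (auto simp: S_def)
    moreover have "x i \<noteq> 0" if "y i \<noteq> 0" for i using that w(4)[of i] by (auto simp: y_def)
    ultimately have "{i \<in> E. y i \<noteq> 0} \<subset> {i \<in> E. x i \<noteq> 0}" by blast
    then have "card {i \<in> E. y i \<noteq> 0} < card {i \<in> E. x i \<noteq> 0}"
      using finite_E by (intro psubset_card_mono) auto
    moreover have "y \<in> W" unfolding y_def by (rule W_lin[OF less.prems(1) w(1)])
    moreover have "\<forall>i. 0 \<le> y i" using c_le by (simp add: y_def)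
    ultimately have "y i \<le> y e" by (rule less.hyps)
    moreover have "c * real (w i) \<le> c * w e" using c_nonneg w(2,3) by (intro mult_left_mono) auto
    ultimately show ?thesis by (simp add: y_def)
  qed auto
qed

text \<open>\<open>T\<close> selects a face, \<open>p\<close> a coset of the integer lattice.
  Bounding the single coordinate \<open>x e\<close> bounds all of them by \<open>le_peak\<close>.
  \<open>p\<close> and \<open>k\<close> are real because the recurrence for these sets leaves the
  integers.\<close>

definition pts :: "('a \<Rightarrow> real) \<Rightarrow> 'a set \<Rightarrow> real \<Rightarrow> ('a \<Rightarrow> real) set" where
  "pts p T k = {x \<in> W. (\<forall>i. 0 \<le> x i) \<and> (\<forall>i\<in>T. x i = 0) \<and> (\<forall>i. x i - p i \<in> \<int>) \<and> x e \<le> k}"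

lemma finite_pts: "finite (pts p T k)"
proof -
  define B where "B = (\<Union>i\<in>E. {t :: real. 0 \<le> t \<and> t \<le> k \<and> t - p i \<in> \<int>})"
  have "finite B" unfolding B_def using finite_E finite_coset_interval by blast
  moreover have "pts p T k \<subseteq> {x. \<forall>i. (i \<in> E \<longrightarrow> x i \<in> B) \<and> (i \<notin> E \<longrightarrow> x i = 0)}"
  proof
    fix x assume x: "x \<in> pts p T k"
    then have "x i \<le> k" for i using le_peak[of x i] by (auto simp: pts_def)
    then show "x \<in> {x. \<forall>i. (i \<in> E \<longrightarrow> x i \<in> B) \<and> (i \<notin> E \<longrightarrow> x i = 0)}"
      using x W_outside by (auto simp: pts_def B_def)
  qed
  ultimately show ?thesis
    using finite_set_of_finite_funs[OF finite_E, of B 0] by (simp add: finite_subset)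
qed

lemma pts_neg: "k < 0 \<Longrightarrow> pts p T k = {}"
proof -
  assume "k < 0"
  have False if "x \<in> pts p T k" for x
  proof -
    have "0 \<le> x e" "x e \<le> k" using that by (auto simp: pts_def)
    with \<open>k < 0\<close> show False by simp
  qed
  then show ?thesis by blast
qed

abbreviation "zero_pts p T S k \<equiv> {x \<in> pts p T k. \<exists>s\<in>S. x s = 0}"

text \<open>Inclusion-exclusion, one coordinate at a time: a point with a zero in
  \<open>insert s S\<close> has a zero in \<open>S\<close>, or vanishes at \<open>s\<close> but
  nowhere in \<open>S\<close>. The latter are counted by \<open>pts\<close> and
  \<open>zero_pts\<close> for \<open>insert s T\<close>. As \<open>S\<close> is disjoint from
  \<open>T\<close>, only counts with strictly more prescribed zeros enter.\<close>

lemma polynomial_zero_pts: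
  assumes "finite S" "S \<subseteq> E" "S \<inter> T = {}"
    and "\<And>T'. T \<subset> T' \<Longrightarrow> T' \<subseteq> E \<union> T \<Longrightarrow>
      polynomial_on_progressions d (\<lambda>k. of_nat (card (pts p T' k)))"
  shows "polynomial_on_progressions d (\<lambda>k. of_nat (card (zero_pts p T S k)))"
  using assms
proof (induction S arbitrary: T)
  case empty
  then show ?case
    by (auto simp: polynomial_on_progressions_def intro!: exI[of _ 0])
next
  case (insert s S)
  have eq: "of_nat (card (zero_pts p T (insert s S) k)) =
      of_nat (card (zero_pts p T S k))
      + (of_nat (card (pts p (insert s T) k)) - (of_nat (card (zero_pts p (insert s T) S k)) :: complex))"
    for k
  proof -
    have "zero_pts p T (insert s S) k
        = zero_pts p T S k \<union> (pts p (insert s T) k - zero_pts p (insert s T) S k)"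
      by (auto simp: pts_def)
    moreover have "zero_pts p T S k \<inter> (pts p (insert s T) k - zero_pts p (insert s T) S k) = {}"
      by (auto simp: pts_def)
    ultimately have "card (zero_pts p T (insert s S) k) = card (zero_pts p T S k)
        + card (pts p (insert s T) k - zero_pts p (insert s T) S k)"
      using finite_pts by (simp add: card_Un_disjoint)
    moreover have "card (pts p (insert s T) k - zero_pts p (insert s T) S k)
        = card (pts p (insert s T) k) - card (zero_pts p (insert s T) S k)"
      using finite_pts by (intro card_Diff_subset) auto
    moreover have "card (zero_pts p (insert s T) S k) \<le> card (pts p (insert s T) k)"
      using finite_pts by (intro card_mono) auto
    ultimately show ?thesis by (simp add: of_nat_diff)
  qed
  show ?case
    unfolding eq
  proof (intro polynomial_on_progressions_add polynomial_on_progressions_diff)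
    show "polynomial_on_progressions d (\<lambda>k. of_nat (card (zero_pts p T S k)))"
      using insert.prems by (intro insert.IH) auto
    show "polynomial_on_progressions d (\<lambda>k. of_nat (card (pts p (insert s T) k)))"
      using insert.prems by auto
    show "polynomial_on_progressions d (\<lambda>k. of_nat (card (zero_pts p (insert s T) S k)))"
    proof (rule insert.IH)
      show "S \<inter> insert s T = {}" using insert by auto
      show "polynomial_on_progressions d (\<lambda>k. of_nat (card (pts p T' k)))"
        if "insert s T \<subset> T'" "T' \<subseteq> E \<union> insert s T" for T'
        using that insert.prems by (intro insert.prems(3)) auto
    qed (use insert.prems in auto)
  qed
qed

text \<open>Points are sorted by the largest \<open>c\<close> with \<open>c * w \<le> x\<close>. If
  \<open>c \<ge> 1\<close>, subtract \<open>w\<close>; otherwise subtract \<open>c * w\<close>,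
  which leaves a zero on \<open>S\<close> and moves the coset. \<open>C\<close> lists the values of
  \<open>c < 1\<close> allowed by integrality: equality \<open>x s = c * w s\<close> at some
  \<open>s\<close> forces \<open>p s - c * w s\<close> to be an integer.\<close>

lemma card_pts_recurrence:
  fixes w :: "'a \<Rightarrow> nat" and p :: "'a \<Rightarrow> real" and k :: real
  assumes w: "(\<lambda>i. real (w i)) \<in> W" "w e = d" "\<And>i. i \<in> T \<Longrightarrow> w i = 0"
  defines "S \<equiv> {i \<in> E. w i \<noteq> 0}"
  defines "(C :: real set) \<equiv> {c. 0 \<le> c \<and> c < 1 \<and> (\<exists>s\<in>S. p s - c * real (w s) \<in> \<int>)}"
  shows "finite C"
    and "card (pts p T k) = card (pts p T (k - d))
      + (\<Sum>c\<in>C. card (zero_pts (\<lambda>i. p i - c * real (w i)) T S (k - d * c)))"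
proof -
  have w_out: "w i = 0" if "i \<notin> E" for i using W_outside[OF w(1) that] by simp
  have S: "finite S" "e \<in> S" using finite_E e_in w(2) d_pos by (auto simp: S_def)
  have S_pos: "real (w s) > 0" if "s \<in> S" for s using that by (simp add: S_def)
  show finC: "finite C"
  proof (rule finite_subset)
    show "C \<subseteq> (\<Union>s\<in>S. (\<lambda>t :: real. t / real (w s)) ` {t :: real. 0 \<le> t \<and> t \<le> real (w s) \<and> t - p s \<in> \<int>})"
    proof
      fix c assume "c \<in> C"
      then obtain s where s: "0 \<le> c" "c < 1" "s \<in> S" "p s - c * real (w s) \<in> \<int>" by (auto simp: C_def)
      then have "c * real (w s) - p s \<in> \<int>" by (metis Ints_minus minus_diff_eq)
      moreover have "c * real (w s) \<le> w s" using s by (simp add: mult_left_le_one_le)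
      moreover have "c = c * real (w s) / w s" using S_pos[OF s(3)] by simp
      ultimately show "c \<in> (\<Union>s\<in>S. (\<lambda>t. t / real (w s)) ` {t :: real. 0 \<le> t \<and> t \<le> real (w s) \<and> t - p s \<in> \<int>})"
        using s by (intro UN_I[OF s(3)] image_eqI[of _ _ "c * real (w s)"]) auto
    qed
    show "finite (\<Union>s\<in>S. (\<lambda>t :: real. t / real (w s)) ` {t :: real. 0 \<le> t \<and> t \<le> real (w s) \<and> t - p s \<in> \<int>})"
      using S finite_coset_interval by blast
  qed
  define A where "A = {x \<in> pts p T k. \<forall>i. real (w i) \<le> x i}"
  \<comment> \<open>Equality at some \<open>s\<close> makes \<open>c\<close> the largest multiple of
    \<open>w\<close> that fits below \<open>x\<close>, so distinct \<open>D c\<close> are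
    disjoint.\<close>
  define D where "D = (\<lambda>c :: real. {x \<in> pts p T k. (\<forall>i. c * real (w i) \<le> x i) \<and> (\<exists>s\<in>S. x s = c * real (w s))})"
  have finD: "finite (D c)" for c unfolding D_def using finite_pts by simp
  have finA: "finite A" unfolding A_def using finite_pts by simp
  have cover: "pts p T k = A \<union> (\<Union>c\<in>C. D c)"
  proof
    show "pts p T k \<subseteq> A \<union> (\<Union>c\<in>C. D c)"
    proof
      fix x assume x: "x \<in> pts p T k"
      show "x \<in> A \<union> (\<Union>c\<in>C. D c)"
      proof (cases "x \<in> A")
        case False
        then obtain j where j: "x j < w j" using x by (auto simp: A_def not_le)
        define c where "c = Min ((\<lambda>i. x i / w i) ` S)"
        have "c \<in> (\<lambda>i. x i / w i) ` S" unfolding c_def using S by (intro Min_in) auto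
        then obtain s where s: "s \<in> S" "c = x s / w s" by blast
        have x_nonneg: "0 \<le> x i" for i using x by (simp add: pts_def)
        have c_le: "c * real (w i) \<le> x i" for i
        proof (cases "i \<in> S")
          case True
          then have "c \<le> x i / w i" unfolding c_def using S by (intro Min_le) auto
          then show ?thesis using S_pos[OF True] by (simp add: field_simps)
        next
          case False
          then have "w i = 0" using w_out by (auto simp: S_def)
          then show ?thesis using x_nonneg by simp
        qed
        have xs: "x s = c * real (w s)" using s S_pos by simp
        have "c < 1"
        proof (rule ccontr)
          assume "\<not> c < 1"
          then have "w j \<le> c * w j" by (simp add: mult_le_cancel_right1)
          with c_le[of j] j show False by linarith
        qed
        moreover have "c \<ge> 0" using s x_nonneg by simp
        moreover have "p s - c * real (w s) \<in> \<int>"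
        proof -
          have "x s - p s \<in> \<int>" using x by (simp add: pts_def)
          then have "- (x s - p s) \<in> \<int>" by (rule Ints_minus)
          then show ?thesis by (simp add: xs)
        qed
        ultimately have "c \<in> C" unfolding C_def using s(1) by blast
        moreover have "x \<in> D c" unfolding D_def using x c_le xs s(1) by blast
        ultimately show ?thesis by blast
      qed simp
    qed
    show "A \<union> (\<Union>c\<in>C. D c) \<subseteq> pts p T k" unfolding A_def D_def by blast
  qed
  have disj: "D c \<inter> D c' = {}" if "c < c'" for c c' :: real
  proof -
    have False if x: "x \<in> D c" "x \<in> D c'" for x
    proof -
      obtain s where s: "s \<in> S" "x s = c * real (w s)" using x unfolding D_def by blast
      have "c' * w s \<le> x s" using x unfolding D_def by blast
      moreover have "c * real (w s) < c' * w s" using S_pos[OF s(1)] \<open>c < c'\<close> by simp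
      ultimately show False using s by simp
    qed
    then show ?thesis by blast
  qed
  have disjA: "A \<inter> D c = {}" if "c < 1" for c :: real
  proof -
    have False if x: "x \<in> A" "x \<in> D c" for x
    proof -
      obtain s where s: "s \<in> S" "x s = c * real (w s)" using x unfolding D_def by blast
      have "w s \<le> x s" using x unfolding A_def by blast
      moreover have "c * real (w s) < w s" using S_pos[OF s(1)] \<open>c < 1\<close> by simp
      ultimately show False using s by simp
    qed
    then show ?thesis by blast
  qed
  \<comment> \<open>\<open>w\<close> is integral and vanishes on \<open>T\<close>, so coset and face
    stay the same, while the bound drops by \<open>w e = d\<close>. The explicit factors
    \<open>-1\<close> and \<open>1\<close> match \<open>W_lin\<close>.\<close>
  have "bij_betw (\<lambda>x i. x i + (-1) * real (w i)) A (pts p T (k - d))"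
  proof (rule bij_betw_byWitness[where f' = "\<lambda>x i. x i + 1 * real (w i)"])
    show "(\<lambda>x i. x i + (-1) * real (w i)) ` A \<subseteq> pts p T (k - d)"
    proof clarify
      fix x assume "x \<in> A"
      then have x: "x \<in> W" "x e \<le> k" "\<And>i. i \<in> T \<Longrightarrow> x i = 0" "\<And>i. x i - p i \<in> \<int>"
          "\<And>i. w i \<le> x i"
        by (auto simp: A_def pts_def)
      have "x i - p i - w i \<in> \<int>" for i using x(4) by (rule Ints_diff) simp
      then have "x i + (-1) * real (w i) - p i \<in> \<int>" for i by (simp add: algebra_simps)
      then show "(\<lambda>i. x i + (-1) * real (w i)) \<in> pts p T (k - d)"
        unfolding pts_def using W_lin[OF x(1) w(1), of "-1"] x(2-5) w(2,3) by simp
    qed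
    show "(\<lambda>x i. x i + 1 * real (w i)) ` pts p T (k - d) \<subseteq> A"
    proof clarify
      fix x assume "x \<in> pts p T (k - d)"
      then have x: "x \<in> W" "x e \<le> k - d" "\<And>i. i \<in> T \<Longrightarrow> x i = 0" "\<And>i. x i - p i \<in> \<int>"
          "\<And>i. 0 \<le> x i"
        by (auto simp: pts_def)
      have "x i - p i + w i \<in> \<int>" for i using x(4) by (rule Ints_add) simp
      then have "x i + 1 * real (w i) - p i \<in> \<int>" for i by (simp add: algebra_simps)
      then show "(\<lambda>i. x i + 1 * real (w i)) \<in> A"
        unfolding A_def pts_def using W_lin[OF x(1) w(1), of 1] x(2-5) w(2,3) by simp
    qed
  qed auto
  then have cardA: "card A = card (pts p T (k - d))" by (rule bij_betw_same_card)
  have cardD: "card (D c) = card (zero_pts (\<lambda>i. p i - c * real (w i)) T S (k - d * c))"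
    if cC: "c \<in> C" for c :: real
  proof -
    \<comment> \<open>Here the coset changes by \<open>c * w\<close> and the bound by
      \<open>c * d\<close>; equality on \<open>S\<close> turns into a zero on
      \<open>S\<close>.\<close>
    have "bij_betw (\<lambda>x i. x i + (-c) * real (w i)) (D c) (zero_pts (\<lambda>i. p i - c * real (w i)) T S (k - d * c))"
    proof (rule bij_betw_byWitness[where f' = "\<lambda>x i. x i + c * real (w i)"])
      have c: "0 \<le> c" using cC by (simp add: C_def)
      show "(\<lambda>x i. x i + (-c) * real (w i)) ` D c \<subseteq> zero_pts (\<lambda>i. p i - c * real (w i)) T S (k - d * c)"
      proof (rule image_subsetI)
        fix x assume "x \<in> D c"
        then have x: "x \<in> W" "x e \<le> k" "\<And>i. i \<in> T \<Longrightarrow> x i = 0" "\<And>i. x i - p i \<in> \<int>"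
            "\<And>i. c * real (w i) \<le> x i" "\<exists>s\<in>S. x s = c * real (w s)"
          by (auto simp: D_def pts_def)
        show "(\<lambda>i. x i + (-c) * real (w i)) \<in> zero_pts (\<lambda>i. p i - c * real (w i)) T S (k - d * c)"
          unfolding pts_def using W_lin[OF x(1) w(1), of "-c"] x(2-6) w(2,3)
          by (simp add: mult.commute)
      qed
      show "(\<lambda>x i. x i + c * real (w i)) ` zero_pts (\<lambda>i. p i - c * real (w i)) T S (k - d * c) \<subseteq> D c"
      proof (rule image_subsetI)
        fix x assume "x \<in> zero_pts (\<lambda>i. p i - c * real (w i)) T S (k - d * c)"
        then have x: "x \<in> W" "x e \<le> k - d * c" "\<And>i. i \<in> T \<Longrightarrow> x i = 0"
            "\<And>i. x i - (p i - c * real (w i)) \<in> \<int>" "\<And>i. 0 \<le> x i" "\<exists>s\<in>S. x s = 0"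
          by (auto simp: pts_def)
        have "x i + c * real (w i) - p i \<in> \<int>" for i using x(4)[of i] by (simp add: algebra_simps)
        then show "(\<lambda>i. x i + c * real (w i)) \<in> D c"
          unfolding D_def pts_def using W_lin[OF x(1) w(1), of c] x(2,3,5,6) w(2,3) c
          by (simp add: mult.commute)
      qed
    qed auto
    then show ?thesis by (rule bij_betw_same_card)
  qed
  have "card (pts p T k) = card A + card (\<Union>c\<in>C. D c)"
    unfolding cover using finA finC finD disjA by (intro card_Un_disjoint) (auto simp: C_def)
  also have "card (\<Union>c\<in>C. D c) = (\<Sum>c\<in>C. card (D c))"
    using finC finD disj by (intro card_UN_disjoint) (auto, metis IntI empty_iff linorder_neqE)
  finally show "card (pts p T k) = card (pts p T (k - d))
      + (\<Sum>c\<in>C. card (zero_pts (\<lambda>i. p i - c * real (w i)) T S (k - d * c)))"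
    by (simp add: cardA cardD)
qed

text \<open>Induction on the number of coordinates not forced to zero, for all cosets at once since
  the recurrence changes \<open>p\<close>. A nonzero point of the face yields by \<open>peak\<close>
  a vector \<open>w\<close> in the same face; the recurrence then involves only the count itself at
  \<open>k - d\<close> and counts for larger \<open>T'\<close>.\<close>

theorem polynomial_pts:
  assumes "T \<subseteq> E"
  shows "polynomial_on_progressions d (\<lambda>k. of_nat (card (pts p T k)))"
  using assms
proof (induction "card (E - T)" arbitrary: T p rule: less_induct)
  case less
  show ?case
  proof (cases "\<exists>x\<in>W. (\<forall>i. 0 \<le> x i) \<and> (\<forall>i\<in>T. x i = 0) \<and> (\<exists>j. x j \<noteq> 0)")
    case True
    then obtain x j where x: "x \<in> W" "\<forall>i. 0 \<le> x i" "\<And>i. i \<in> T \<Longrightarrow> x i = 0" "x j \<noteq> 0" by blast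
    obtain w where w: "(\<lambda>i. real (w i)) \<in> W" "w e = d" "\<And>i. w i \<noteq> 0 \<Longrightarrow> x i \<noteq> 0"
      using peak[OF x(1,2,4)] by blast
    have wT: "w i = 0" if "i \<in> T" for i using x(3)[OF that] w(3)[of i] by auto
    let ?S = "{i \<in> E. w i \<noteq> 0}"
    let ?C = "{c :: real. 0 \<le> c \<and> c < 1 \<and> (\<exists>s\<in>?S. p s - c * real (w s) \<in> \<int>)}"
    show ?thesis
    proof (rule polynomial_on_progressions_recurrence[OF d_pos, where C = ?C and
          g = "\<lambda>c k. of_nat (card (zero_pts (\<lambda>i. p i - c * real (w i)) T ?S k))"])
      show "finite ?C" by (rule card_pts_recurrence(1)[OF w(1,2) wT])
      show "(of_nat (card (pts p T k)) :: complex) = of_nat (card (pts p T (k - real d)))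
          + (\<Sum>c\<in>?C. of_nat (card (zero_pts (\<lambda>i. p i - c * real (w i)) T ?S (k - real d * c))))" for k
      proof -
        have "card (pts p T k) = card (pts p T (k - real d))
            + (\<Sum>c\<in>?C. card (zero_pts (\<lambda>i. p i - c * real (w i)) T ?S (k - real d * c)))"
          by (rule card_pts_recurrence(2)[OF w(1,2) wT])
        then show ?thesis by (simp only: of_nat_add of_nat_sum)
      qed
      show "polynomial_on_progressions d
          (\<lambda>k. of_nat (card (zero_pts (\<lambda>i. p i - c * real (w i)) T ?S k)))" for c :: real
      proof (rule polynomial_zero_pts)
        show "polynomial_on_progressions d (\<lambda>k. of_nat (card (pts (\<lambda>i. p i - c * real (w i)) T' k)))"
          if "T \<subset> T'" "T' \<subseteq> E \<union> T" for T'
        proof (rule less.hyps)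
          show "card (E - T') < card (E - T)"
            using that less.prems finite_E by (intro psubset_card_mono) auto
          show "T' \<subseteq> E" using that less.prems by blast
        qed
      qed (use finite_E wT in auto)
    qed (auto simp: pts_neg)
  next
    case False
    \<comment> \<open>The face contains no point but the origin, so the count is the same for every
      \<open>k \<ge> 0\<close>.\<close>
    have pts_0: "pts p T k = pts p T 0" if "0 \<le> k" for k
    proof -
      have x_e: "x e = 0" if "x \<in> W" "\<forall>i. 0 \<le> x i" "\<forall>i\<in>T. x i = 0" for x using False that by blast
      have "x e \<le> k \<longleftrightarrow> x e \<le> 0" if "x \<in> W" "\<forall>i. 0 \<le> x i" "\<forall>i\<in>T. x i = 0" for x
        using x_e[OF that] \<open>0 \<le> k\<close> by simp
      then show ?thesis unfolding pts_def by blast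
    qed
    show ?thesis
      unfolding polynomial_on_progressions_def
    proof (intro allI impI exI)
      fix r :: real and n :: nat
      assume "0 \<le> r \<and> r < real d"
      then have "pts p T (r + real d * real n) = pts p T 0" by (intro pts_0) simp
      then show "of_nat (card (pts p T (r + real d * real n)))
          = poly [:of_nat (card (pts p T 0)):] (of_nat n :: complex)"
        by (simp only: poly_pCons poly_0) simp
    qed
  qed
qed

end

section \<open>Hall's marriage theorem\<close>

text \<open>Halmos-Vaughan argument: if some nonempty proper subfamily is tight, match it first and
  match the rest outside its union; if none is, any choice for one index leaves enough for the
  others.\<close>

theorem hall_marriage:
  assumes "finite I" and "\<And>i. i \<in> I \<Longrightarrow> finite (A i)"
    and "\<And>J. J \<subseteq> I \<Longrightarrow> card J \<le> card (\<Union>i\<in>J. A i)"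
  obtains f where "inj_on f I" "\<And>i. i \<in> I \<Longrightarrow> f i \<in> A i"
proof -
  have "\<exists>f. inj_on f I \<and> (\<forall>i\<in>I. f i \<in> A i)"
    using assms
  proof (induction "card I" arbitrary: I A rule: less_induct)
    case less
    note fin = less.prems(1,2) and hall = less.prems(3)
    show ?case
    proof (cases "\<exists>J. J \<noteq> {} \<and> J \<subset> I \<and> card (\<Union>i\<in>J. A i) = card J")
      case True
      then obtain J where J: "J \<noteq> {}" "J \<subset> I" "card (\<Union>i\<in>J. A i) = card J" by blast
      have finJ: "finite J" using J fin finite_subset by blast
      have "card J < card I" using J fin by (intro psubset_card_mono) auto
      moreover have "card K \<le> card (\<Union>i\<in>K. A i)" if "K \<subseteq> J" for K using that J by (intro hall) auto
      ultimately have "\<exists>f. inj_on f J \<and> (\<forall>i\<in>J. f i \<in> A i)"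
        using finJ fin(2) J(2) by (intro less.hyps) auto
      then obtain f where f: "inj_on f J" "\<forall>i\<in>J. f i \<in> A i" by blast
      let ?U = "\<Union>i\<in>J. A i"
      have "card (I - J) < card I" using J fin by (intro psubset_card_mono) auto
      \<comment> \<open>Apply the condition to \<open>K \<union> J\<close>: by tightness
        \<open>J\<close> accounts for exactly \<open>card J\<close> elements of the union.\<close>
      moreover have "card K \<le> card (\<Union>i\<in>K. A i - ?U)" if K: "K \<subseteq> I - J" for K
      proof -
        have finK: "finite K" using K fin finite_subset by blast
        have "card K + card J = card (K \<union> J)" using K finK finJ by (intro card_Un_disjoint [symmetric]) auto
        also have "\<dots> \<le> card (\<Union>i\<in>K \<union> J. A i)" using K J by (intro hall) auto
        also have "(\<Union>i\<in>K \<union> J. A i) = (\<Union>i\<in>K. A i - ?U) \<union> ?U" by auto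
        also have "card \<dots> \<le> card (\<Union>i\<in>K. A i - ?U) + card ?U" by (rule card_Un_le)
        finally show ?thesis using J by simp
      qed
      moreover have "finite (I - J)" "\<And>i. i \<in> I - J \<Longrightarrow> finite (A i - ?U)" using fin by auto
      ultimately have "\<exists>g. inj_on g (I - J) \<and> (\<forall>i\<in>I - J. g i \<in> A i - ?U)"
        by (intro less.hyps)
      then obtain g where g: "inj_on g (I - J)" "\<forall>i\<in>I - J. g i \<in> A i - ?U" by blast
      let ?h = "\<lambda>i. if i \<in> J then f i else g i"
      have "f ` J \<subseteq> ?U" "g ` (I - J) \<subseteq> - ?U" using f(2) g(2) by auto
      then have "f ` J \<inter> g ` (I - J) = {}" by blast
      then have "inj_on ?h (J \<union> (I - J))" using f(1) g(1) by (intro inj_on_disjoint_Un)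
      moreover have "J \<union> (I - J) = I" using J(2) by blast
      ultimately have "inj_on ?h I" by simp
      moreover have "\<forall>i\<in>I. ?h i \<in> A i"
      proof
        fix i assume "i \<in> I"
        then show "?h i \<in> A i" using f(2) g(2) by (cases "i \<in> J") auto
      qed
      ultimately show ?thesis by blast
    next
      case not_tight: False
      show ?thesis
      proof (cases "I = {}")
        case False
        then obtain i where i: "i \<in> I" by blast
        have "card {i} \<le> card (\<Union>j\<in>{i}. A j)" using i by (intro hall) auto
        then have "A i \<noteq> {}" by auto
        then obtain a where a: "a \<in> A i" by blast
        have "card (I - {i}) < card I" using i fin by (intro psubset_card_mono) auto
        moreover have "card K \<le> card (\<Union>j\<in>K. A j - {a})" if K: "K \<subseteq> I - {i}" for K
        proof (cases "K = {}")
          case False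
          have "card K \<le> card (\<Union>j\<in>K. A j)" using K by (intro hall) auto
          \<comment> \<open>\<open>K\<close> is nonempty and proper, hence not tight; the surplus
            element makes up for the loss of \<open>a\<close>.\<close>
          moreover have "card K \<noteq> card (\<Union>j\<in>K. A j)"
          proof -
            have "K \<subset> I" using K i by blast
            then show ?thesis using not_tight False by metis
          qed
          ultimately have "card K \<le> card (\<Union>j\<in>K. A j) - 1" by simp
          also have "\<dots> \<le> card ((\<Union>j\<in>K. A j) - {a})"
            by (simp add: card_Diff_singleton_if)
          also have "(\<Union>j\<in>K. A j) - {a} = (\<Union>j\<in>K. A j - {a})" by auto
          finally show ?thesis .
        qed simp
        moreover have "finite (I - {i})" "\<And>j. j \<in> I - {i} \<Longrightarrow> finite (A j - {a})" using fin by auto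
        ultimately have "\<exists>g. inj_on g (I - {i}) \<and> (\<forall>j\<in>I - {i}. g j \<in> A j - {a})"
          by (intro less.hyps)
        then obtain g where g: "inj_on g (I - {i})" "\<forall>j\<in>I - {i}. g j \<in> A j - {a}" by blast
        have "inj_on (g(i := a)) (insert i (I - {i}))"
          using g by (subst inj_on_insert) (auto simp: inj_on_def)
        then have "inj_on (g(i := a)) I" using i by (simp add: insert_absorb)
        moreover have "\<forall>j\<in>I. (g(i := a)) j \<in> A j" using g a by auto
        ultimately show ?thesis by blast
      qed simp
    qed
  qed
  with that show thesis by blast
qed

section \<open>Magic labelings of low index\<close>

lemma graph_finite: "graph V E \<Longrightarrow> finite V \<and> finite E"
  unfolding graph_def
proof (intro conjI; elim conjE)
  assume "finite V" "E \<subseteq> {{u, v} |u v. u \<in> V \<and> v \<in> V}"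
  then have "E \<subseteq> Pow V" by auto
  then show "finite E" using \<open>finite V\<close> by (simp add: finite_subset)
qed

lemma graph_edge_cases:
  assumes "graph V E" "\<epsilon> \<in> E"
  obtains u v where "\<epsilon> = {u, v}" "u \<in> V" "v \<in> V"
  using assms unfolding graph_def by blast

text \<open>Identifies vertex sums with column sums of the symmetric matrix with entries
  \<open>L {u, v}\<close>. A loop corresponds to the diagonal entry \<open>u = v\<close> and so is
  counted once.\<close>

lemma vertex_sum_eq_neighbours:
  assumes "graph V E" "v \<in> V"
  shows "vertex_sum E L v = (\<Sum>u | u \<in> V \<and> {u, v} \<in> E. L {u, v})"
proof -
  have "bij_betw (\<lambda>u. {u, v}) {u \<in> V. {u, v} \<in> E} {\<epsilon> \<in> E. v \<in> \<epsilon>}"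
  proof (rule bij_betwI')
    show "\<exists>u\<in>{u \<in> V. {u, v} \<in> E}. \<epsilon> = {u, v}" if "\<epsilon> \<in> {\<epsilon> \<in> E. v \<in> \<epsilon>}" for \<epsilon>
    proof -
      have "\<epsilon> \<in> E" using that by simp
      then obtain a b where "\<epsilon> = {a, b}" "a \<in> V" "b \<in> V" using graph_edge_cases[OF assms(1)] by metis
      with that show ?thesis by (auto simp: insert_commute)
    qed
  qed (auto simp: doubleton_eq_iff)
  then show ?thesis
    unfolding vertex_sum_def by (rule sum.reindex_bij_betw [symmetric])
qed

text \<open>Hall's condition by double counting in the symmetric matrix \<open>a\<close>, all of
  whose line sums are \<open>r\<close>: the rows in \<open>J\<close> have total
  \<open>card J * r\<close>, located in the columns of their neighbourhood, whose total is
  \<open>r\<close> times their number.\<close>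

lemma support_permutation:
  fixes x :: "'v set \<Rightarrow> real"
  assumes G: "graph V E" and nonneg: "\<And>\<epsilon>. \<epsilon> \<in> E \<Longrightarrow> 0 \<le> x \<epsilon>"
    and sums: "\<And>v. v \<in> V \<Longrightarrow> vertex_sum E x v = r" and r: "r > 0"
  obtains f where "bij_betw f V V" "\<And>v. v \<in> V \<Longrightarrow> {v, f v} \<in> E \<and> x {v, f v} \<noteq> 0"
proof -
  have finV: "finite V" using graph_finite[OF G] by simp
  define a where "a = (\<lambda>u v. if {u, v} \<in> E then x {u, v} else 0)"
  have a_sym: "a u v = a v u" for u v by (simp add: a_def insert_commute)
  have a_nonneg: "0 \<le> a u v" for u v using nonneg by (simp add: a_def)
  have a_sum: "(\<Sum>u\<in>V. a u v) = r" if "v \<in> V" for v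
  proof -
    have "r = (\<Sum>u | u \<in> V \<and> {u, v} \<in> E. x {u, v})"
      using sums[OF that] vertex_sum_eq_neighbours[OF G that, of x] by simp
    also have "\<dots> = (\<Sum>u\<in>V. a u v)"
      using finV by (simp add: a_def sum.inter_filter)
    finally show ?thesis by simp
  qed
  define N where "N = (\<lambda>u. {v \<in> V. a u v \<noteq> 0})"
  obtain f where f: "inj_on f V" "\<And>v. v \<in> V \<Longrightarrow> f v \<in> N v"
  proof (rule hall_marriage)
    fix J assume J: "J \<subseteq> V"
    have NJ: "(\<Union>u\<in>J. N u) \<subseteq> V" by (auto simp: N_def)
    have "card J * r = (\<Sum>u\<in>J. \<Sum>v\<in>V. a u v)"
    proof -
      have "(\<Sum>v\<in>V. a u v) = r" if "u \<in> J" for u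
        using that J a_sum[of u] by (subst a_sym) auto
      then show ?thesis by simp
    qed
    also have "\<dots> = (\<Sum>u\<in>J. \<Sum>v\<in>(\<Union>u\<in>J. N u). a u v)"
      using finV NJ by (intro sum.cong sum.mono_neutral_right) (auto simp: N_def)
    also have "\<dots> = (\<Sum>v\<in>(\<Union>u\<in>J. N u). \<Sum>u\<in>J. a u v)" by (rule sum.swap)
    also have "\<dots> \<le> (\<Sum>v\<in>(\<Union>u\<in>J. N u). \<Sum>u\<in>V. a u v)"
      using finV J a_nonneg by (intro sum_mono sum_mono2) auto
    also have "\<dots> = card (\<Union>u\<in>J. N u) * r"
    proof -
      have "(\<Sum>u\<in>V. a u v) = r" if "v \<in> (\<Union>u\<in>J. N u)" for v
        using a_sum NJ that by blast
      then show ?thesis by simp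
    qed
    finally show "card J \<le> card (\<Union>u\<in>J. N u)" using r by simp
  qed (use finV in \<open>auto simp: N_def\<close>)
  have "f ` V \<subseteq> V" using f(2) by (auto simp: N_def)
  then have "bij_betw f V V" using f(1) finV by (simp add: bij_betw_def endo_inj_surj)
  moreover have "{v, f v} \<in> E \<and> x {v, f v} \<noteq> 0" if "v \<in> V" for v
    using f(2)[OF that] by (auto simp: N_def a_def split: if_splits)
  ultimately show thesis using that by blast
qed

text \<open>Weights \<open>c z\<close> are put on edges \<open>m z\<close>, possibly several on one
  edge; regrouping the sum by \<open>z\<close> lets each vertex sum be read off directly.\<close>

lemma vertex_sum_indicators:
  assumes "finite E" "finite Z" "\<And>z. z \<in> Z \<Longrightarrow> m z \<in> E"
  shows "vertex_sum E (\<lambda>\<epsilon>. \<Sum>z | z \<in> Z \<and> m z = \<epsilon>. c z) v = (\<Sum>z | z \<in> Z \<and> v \<in> m z. c z)"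
proof -
  have "vertex_sum E (\<lambda>\<epsilon>. \<Sum>z | z \<in> Z \<and> m z = \<epsilon>. c z) v
      = (\<Sum>\<epsilon> | \<epsilon> \<in> E \<and> v \<in> \<epsilon>. \<Sum>z | z \<in> {z \<in> Z. v \<in> m z} \<and> m z = \<epsilon>. c z)"
    unfolding vertex_sum_def by (intro sum.cong) auto
  also have "\<dots> = (\<Sum>z | z \<in> Z \<and> v \<in> m z. c z)"
    using assms by (intro sum.group) auto
  finally show ?thesis .
qed

text \<open>The symmetrisation $P + P^T$ of a permutation matrix, read as a labeling.\<close>

lemma index_two_labeling_in_support:
  fixes x :: "'v set \<Rightarrow> real"
  assumes G: "graph V E" and "\<And>\<epsilon>. \<epsilon> \<in> E \<Longrightarrow> 0 \<le> x \<epsilon>"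
    and "\<And>v. v \<in> V \<Longrightarrow> vertex_sum E x v = r" and "r > 0"
  obtains F :: "'v set \<Rightarrow> nat"
    where "\<And>v. v \<in> V \<Longrightarrow> vertex_sum E F v = 2" "\<And>\<epsilon>. F \<epsilon> \<noteq> 0 \<Longrightarrow> \<epsilon> \<in> E \<and> x \<epsilon> \<noteq> 0"
proof -
  obtain f where f: "bij_betw f V V" "\<And>v. v \<in> V \<Longrightarrow> {v, f v} \<in> E \<and> x {v, f v} \<noteq> 0"
    using support_permutation[OF assms] by blast
  have fin: "finite V" "finite E" using graph_finite[OF G] by auto
  \<comment> \<open>A vertex gets 1 from its own edge and 1 from the edge of its preimage. For a
    fixed point the two coincide in a loop, which touches its vertex only once, hence the weight
    2.\<close>
  define c where "c = (\<lambda>v. if f v = v then 2 else 1 :: nat)"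
  define F where "F = (\<lambda>\<epsilon>. \<Sum>z | z \<in> V \<and> {z, f z} = \<epsilon>. c z)"
  have "vertex_sum E F v = 2" if v: "v \<in> V" for v
  proof -
    obtain u where u: "u \<in> V" "f u = v" using f(1) v by (metis bij_betw_def imageE)
    have "u' = u" if "u' \<in> V" "f u' = v" for u'
      using inj_onD[OF bij_betw_imp_inj_on[OF f(1)], of u' u] that u by simp
    then have "z \<in> V \<and> v \<in> {z, f z} \<longleftrightarrow> z \<in> {u, v}" for z using u v by blast
    then have "{z. z \<in> V \<and> v \<in> {z, f z}} = {u, v}" by blast
    moreover have "vertex_sum E F v = (\<Sum>z | z \<in> V \<and> v \<in> {z, f z}. c z)"
      unfolding F_def using fin f by (intro vertex_sum_indicators) auto
    moreover have "(\<Sum>z\<in>{u, v}. c z) = 2"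
    proof (cases "u = v")
      case True
      then show ?thesis using u by (simp add: c_def)
    next
      case False
      moreover have "f v \<noteq> v" using inj_onD[OF bij_betw_imp_inj_on[OF f(1)], of v u] False u v by auto
      ultimately show ?thesis using u by (auto simp: c_def)
    qed
    ultimately show ?thesis by simp
  qed
  moreover have "\<epsilon> \<in> E \<and> x \<epsilon> \<noteq> 0" if F: "F \<epsilon> \<noteq> 0" for \<epsilon>
  proof -
    obtain z where "z \<in> V" "{z, f z} = \<epsilon>" using F unfolding F_def
      by (metis (mono_tags, lifting) mem_Collect_eq sum.not_neutral_contains_not_neutral)
    then show ?thesis using f(2)[of z] by simp
  qed
  ultimately show thesis using that by blast
qed

text \<open>In a bipartite graph the permutation exchanges the two sides, so the edges
  \<open>{z, f z}\<close> with \<open>z\<close> in \<open>A\<close> alone form a perfect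
  matching.\<close>

lemma index_one_labeling_in_support:
  fixes x :: "'v set \<Rightarrow> real"
  assumes G: "graph V E" and "\<And>\<epsilon>. \<epsilon> \<in> E \<Longrightarrow> 0 \<le> x \<epsilon>"
    and "\<And>v. v \<in> V \<Longrightarrow> vertex_sum E x v = r" and "r > 0" and bip: "bipartite V E"
  obtains F :: "'v set \<Rightarrow> nat"
    where "\<And>v. v \<in> V \<Longrightarrow> vertex_sum E F v = 1" "\<And>\<epsilon>. F \<epsilon> \<noteq> 0 \<Longrightarrow> \<epsilon> \<in> E \<and> x \<epsilon> \<noteq> 0"
proof -
  obtain f where f: "bij_betw f V V" "\<And>v. v \<in> V \<Longrightarrow> {v, f v} \<in> E \<and> x {v, f v} \<noteq> 0"
    using support_permutation[OF assms(1-4)] by blast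
  have fin: "finite V" "finite E" using graph_finite[OF G] by auto
  obtain A B where AB: "A \<union> B = V" "A \<inter> B = {}" "\<forall>e\<in>E. \<exists>a\<in>A. \<exists>b\<in>B. e = {a, b}"
    using bip unfolding bipartite_def by blast
  have side: "f v \<in> A \<longleftrightarrow> v \<notin> A" if v: "v \<in> V" for v
  proof -
    obtain a b where "a \<in> A" "b \<in> B" "{v, f v} = {a, b}" using f(2)[OF v] AB(3) by blast
    then show ?thesis using AB(2) by (auto simp: doubleton_eq_iff)
  qed
  define F where "F = (\<lambda>\<epsilon>. \<Sum>z | z \<in> A \<and> {z, f z} = \<epsilon>. 1 :: nat)"
  have "vertex_sum E F v = 1" if v: "v \<in> V" for v
  proof -
    obtain u where u: "u \<in> V" "f u = v" using f(1) v by (metis bij_betw_def imageE)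
    have u': "u' = u" if "u' \<in> V" "f u' = v" for u'
      using inj_onD[OF bij_betw_imp_inj_on[OF f(1)], of u' u] that u by simp
    have A_sub: "z \<in> V" if "z \<in> A" for z using AB(1) that by blast
    \<comment> \<open>A vertex of \<open>A\<close> is met by its own edge only, any other vertex
      only by the edge of its preimage.\<close>
    have "{z. z \<in> A \<and> v \<in> {z, f z}} = {if v \<in> A then v else u}"
    proof (cases "v \<in> A")
      case True
      then have "f z \<noteq> v" if "z \<in> A" for z using side[OF A_sub[OF that]] that by metis
      then show ?thesis using True by auto
    next
      case False
      then have "u \<in> A" using side[OF u(1)] u(2) by simp
      moreover have "z = u" if "z \<in> A" "f z = v" for z using u'[OF A_sub[OF that(1)] that(2)] .
      ultimately have "z \<in> A \<and> v \<in> {z, f z} \<longleftrightarrow> z = u" for z using False u(2) by blast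
      then show ?thesis using False by simp
    qed
    moreover have "vertex_sum E F v = (\<Sum>z | z \<in> A \<and> v \<in> {z, f z}. 1)"
      unfolding F_def
    proof (rule vertex_sum_indicators)
      show "finite A" using fin(1) AB(1) by (metis finite_Un)
      show "{z, f z} \<in> E" if "z \<in> A" for z using f(2) AB(1) that by blast
    qed (rule fin(2))
    ultimately show ?thesis by simp
  qed
  moreover have "\<epsilon> \<in> E \<and> x \<epsilon> \<noteq> 0" if F: "F \<epsilon> \<noteq> 0" for \<epsilon>
  proof -
    obtain z where "z \<in> A" "{z, f z} = \<epsilon>" using F unfolding F_def
      by (metis (mono_tags, lifting) mem_Collect_eq sum.not_neutral_contains_not_neutral)
    then show ?thesis using f(2)[of z] AB(1) by auto
  qed
  ultimately show thesis using that by blast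
qed

section \<open>Vertex sums and the space of real magic labelings\<close>

lemma vertex_sum_cong: "(\<And>\<epsilon>. \<epsilon> \<in> E \<Longrightarrow> L \<epsilon> = L' \<epsilon>) \<Longrightarrow> vertex_sum E L v = vertex_sum E L' v"
  unfolding vertex_sum_def by (intro sum.cong) auto

lemma vertex_sum_of_nat: "vertex_sum E (\<lambda>\<epsilon>. of_nat (L \<epsilon>)) v = of_nat (vertex_sum E L v)"
  by (simp add: vertex_sum_def)

lemma vertex_sum_mult:
  fixes c :: "'a::semiring_0"
  shows "vertex_sum E (\<lambda>\<epsilon>. c * L \<epsilon>) v = c * vertex_sum E L v"
  by (simp add: vertex_sum_def sum_distrib_left)

lemma label_le_vertex_sum:
  fixes L :: "'v set \<Rightarrow> 'a::{semiring_1, ordered_comm_monoid_add}"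
  assumes "finite E" "\<epsilon> \<in> E" "v \<in> \<epsilon>" "\<And>\<delta>. \<delta> \<in> E \<Longrightarrow> 0 \<le> L \<delta>"
  shows "L \<epsilon> \<le> vertex_sum E L v"
  unfolding vertex_sum_def by (rule member_le_sum) (use assms in auto)

text \<open>Despite its name this is a linear space: signs are unrestricted, and
  \<open>peaked_cone\<close> adds nonnegativity. Values outside \<open>E\<close> are zero so that
  total functions stand for vectors indexed by \<open>E\<close>.\<close>

definition magic_cone :: "'v set \<Rightarrow> 'v set set \<Rightarrow> ('v set \<Rightarrow> real) set" where
  "magic_cone V E = {x. (\<forall>\<epsilon>. \<epsilon> \<notin> E \<longrightarrow> x \<epsilon> = 0) \<and> (\<exists>r. \<forall>v\<in>V. vertex_sum E x v = r)}"

text \<open>Multiplying by \<open>2 div m\<close> turns an index \<open>m\<close> labeling into one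
  of index 2, to which the hypothesis on \<open>e\<close> applies. If \<open>F e\<close> were zero,
  all labels would be, contrary to the positive index.\<close>

lemma peak_of_low_index:
  assumes G: "graph V E" and e: "e \<in> E"
    and peak: "\<And>L. magic_labeling_of_index V E 2 L \<Longrightarrow> L e = Max (L ` E)"
    and m: "m = 1 \<or> m = (2 :: nat)" and F: "\<And>v. v \<in> V \<Longrightarrow> vertex_sum E F v = m"
  shows "F e \<in> {1..m}" and "\<And>\<epsilon>. \<epsilon> \<in> E \<Longrightarrow> F \<epsilon> \<le> F e"
proof -
  have fin: "finite E" using graph_finite[OF G] by simp
  define L where "L = restrict (\<lambda>\<epsilon>. (2 div m) * F \<epsilon>) E"
  have "magic_labeling_of_index V E 2 L"
    unfolding magic_labeling_of_index_def
  proof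
    have "vertex_sum E L v = (2 div m) * vertex_sum E F v" for v
      unfolding vertex_sum_mult [symmetric] L_def by (intro vertex_sum_cong) simp
    then show "\<forall>v\<in>V. vertex_sum E L v = 2" using F m by auto
  qed (simp add: L_def)
  then have L_le: "L \<epsilon> \<le> L e" if "\<epsilon> \<in> E" for \<epsilon>
    using peak[of L] fin that by (simp add: Max_ge)
  show le: "F \<epsilon> \<le> F e" if "\<epsilon> \<in> E" for \<epsilon>
    using L_le[OF that] that e m by (auto simp: L_def)
  obtain u v where uv: "e = {u, v}" "u \<in> V" using graph_edge_cases[OF G e] by metis
  have "F e \<le> m"
    using label_le_vertex_sum[of E e u F] fin e uv F by simp
  moreover have "F e \<noteq> 0"
  proof
    assume "F e = 0"
    then have "vertex_sum E F u = 0" using le by (simp add: vertex_sum_def)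
    then show False using F uv(2) m by auto
  qed
  ultimately show "F e \<in> {1..m}" by simp
qed

text \<open>\<open>support\<close> is the output of the permutation argument, abstracted so that
  general and bipartite graphs (\<open>m = 2\<close> and \<open>m = 1\<close>) are treated
  together.\<close>

lemma peaked_magic_cone:
  fixes V :: "'v set"
  assumes G: "graph V E" and e: "e \<in> E"
    and peak: "\<And>L. magic_labeling_of_index V E 2 L \<Longrightarrow> L e = Max (L ` E)"
    and m: "m = 1 \<or> m = 2"
    and support: "\<And>x r. (\<And>\<epsilon>. \<epsilon> \<in> E \<Longrightarrow> 0 \<le> x \<epsilon>) \<Longrightarrow>
      (\<And>v. v \<in> V \<Longrightarrow> vertex_sum E x v = r) \<Longrightarrow> r > (0 :: real) \<Longrightarrow>
      \<exists>F :: 'v set \<Rightarrow> nat. (\<forall>v\<in>V. vertex_sum E F v = m) \<and> (\<forall>\<epsilon>. F \<epsilon> \<noteq> 0 \<longrightarrow> \<epsilon> \<in> E \<and> x \<epsilon> \<noteq> 0)"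
  shows "peaked_cone E (magic_cone V E) e m"
proof
  show fin: "finite E" using graph_finite[OF G] by simp
  show "e \<in> E" by (rule e)
  show "m > 0" using m by auto
  show "x i = 0" if "x \<in> magic_cone V E" "i \<notin> E" for x i
    using that by (simp add: magic_cone_def)
  show "(\<lambda>i. x i + c * y i) \<in> magic_cone V E"
    if xy: "x \<in> magic_cone V E" "y \<in> magic_cone V E" for x y c
  proof -
    obtain r s where rs: "\<forall>v\<in>V. vertex_sum E x v = r" "\<forall>v\<in>V. vertex_sum E y v = s"
      using xy by (auto simp: magic_cone_def)
    have "vertex_sum E (\<lambda>i. x i + c * y i) v = vertex_sum E x v + c * vertex_sum E y v" for v
      by (simp add: vertex_sum_def sum.distrib sum_distrib_left)
    then have "\<forall>v\<in>V. vertex_sum E (\<lambda>i. x i + c * y i) v = r + c * s" using rs by simp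
    then show ?thesis using xy by (auto simp: magic_cone_def)
  qed
  show "\<exists>w :: 'v set \<Rightarrow> nat. (\<lambda>i. real (w i)) \<in> magic_cone V E \<and> w e = m \<and> (\<forall>i. w i \<le> m)
      \<and> (\<forall>i. w i \<noteq> 0 \<longrightarrow> x i \<noteq> 0)"
    if x: "x \<in> magic_cone V E" "\<forall>i. 0 \<le> x i" "x j \<noteq> 0" for x j
  proof -
    obtain r where r: "\<And>v. v \<in> V \<Longrightarrow> vertex_sum E x v = r" using x(1) by (auto simp: magic_cone_def)
    have j: "j \<in> E" using x(1,3) by (auto simp: magic_cone_def)
    then obtain u v where uv: "j = {u, v}" "u \<in> V" using graph_edge_cases[OF G j] by metis
    have "x j \<le> r"
      using label_le_vertex_sum[of E j u x] fin j uv x(2) r by simp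
    then have "r > 0" using x(2,3) by (metis less_eq_real_def order_less_le_trans)
    then obtain F where F: "\<And>v. v \<in> V \<Longrightarrow> vertex_sum E F v = m"
        "\<And>\<epsilon>. F \<epsilon> \<noteq> 0 \<Longrightarrow> \<epsilon> \<in> E \<and> x \<epsilon> \<noteq> 0"
      using support[of x r] x(2) r by blast
    note Fe = peak_of_low_index[OF G e peak m F(1)]
    \<comment> \<open>\<open>F e\<close> is in \<open>{1..m}\<close> and \<open>m \<le> 2\<close>,
      so \<open>F e\<close> divides \<open>m\<close>; scaling raises the peak to exactly
      \<open>m\<close>, at the price of possibly changing the index.\<close>
    define w where "w = (\<lambda>i. (m div F e) * F i)"
    have we: "w e = m" using Fe(1) m by (auto simp: w_def numeral_2_eq_2 le_Suc_eq)
    have "w i \<le> m" for i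
    proof (cases "F i = 0")
      case False
      then have "w i \<le> w e" using Fe(2)[of i] F(2)[of i] by (simp add: w_def)
      then show ?thesis using we by simp
    qed (simp add: w_def)
    moreover have "x i \<noteq> 0" if "w i \<noteq> 0" for i using that F(2)[of i] by (auto simp: w_def)
    moreover have "(\<lambda>i. real (w i)) \<in> magic_cone V E"
    proof -
      have "vertex_sum E (\<lambda>i. real (w i)) v = real (m div F e * m)" if "v \<in> V" for v
        unfolding vertex_sum_of_nat w_def vertex_sum_mult using F(1)[OF that] by simp
      moreover have "w i = 0" if "i \<notin> E" for i using F(2)[of i] that by (auto simp: w_def)
      ultimately show ?thesis by (auto simp: magic_cone_def)
    qed
    ultimately show ?thesis using we by blast
  qed
qed

text \<open>\<open>pts\<close> bounds the label of \<open>e\<close> alone, and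
  \<open>le_peak\<close> extends the bound to all edges. The bijection converts between
  \<open>undefined\<close> and 0 outside \<open>E\<close>; the empty \<open>T\<close> and the zero
  coset give all integer points.\<close>

lemma magic_count_eq_card_pts:
  assumes "peaked_cone E (magic_cone V E) e d"
  shows "magic_count V E k = card (peaked_cone.pts (magic_cone V E) e (\<lambda>_. 0) {} (real k))"
proof -
  interpret peaked_cone E "magic_cone V E" e d by (rule assms)
  have "bij_betw (\<lambda>L i. if i \<in> E then real (L i) else 0)
      {L. magic_labeling V E L \<and> (\<forall>e\<in>E. L e \<le> k)} (pts (\<lambda>_. 0) {} (real k))"
  proof (rule bij_betw_byWitness[where f' = "\<lambda>x. restrict (\<lambda>i. nat \<lfloor>x i\<rfloor>) E"])
    show "\<forall>L\<in>{L. magic_labeling V E L \<and> (\<forall>e\<in>E. L e \<le> k)}.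
        restrict (\<lambda>i. nat \<lfloor>if i \<in> E then real (L i) else 0\<rfloor>) E = L"
      by (auto simp: magic_labeling_def magic_labeling_of_index_def extensional_def fun_eq_iff)
    have floor: "real (nat \<lfloor>x i\<rfloor>) = x i" if "x \<in> pts (\<lambda>_. 0) {} (real k)" for x i
    proof -
      have "0 \<le> x i" "x i \<in> \<int>" using that by (simp_all add: pts_def)
      then show ?thesis by (auto elim!: Ints_cases)
    qed
    show "\<forall>x\<in>pts (\<lambda>_. 0) {} (real k).
        (\<lambda>i. if i \<in> E then real (restrict (\<lambda>i. nat \<lfloor>x i\<rfloor>) E i) else 0) = x"
    proof (intro ballI ext)
      fix x i assume x: "x \<in> pts (\<lambda>_. 0) {} (real k)"
      then show "(if i \<in> E then real (restrict (\<lambda>i. nat \<lfloor>x i\<rfloor>) E i) else 0) = x i"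
        using floor[OF x, of i] W_outside[of x i] by (simp add: pts_def)
    qed
    show "(\<lambda>L i. if i \<in> E then real (L i) else 0) ` {L. magic_labeling V E L \<and> (\<forall>e\<in>E. L e \<le> k)}
        \<subseteq> pts (\<lambda>_. 0) {} (real k)"
    proof (rule image_subsetI)
      fix L assume "L \<in> {L. magic_labeling V E L \<and> (\<forall>e\<in>E. L e \<le> k)}"
      then obtain r where r: "\<And>v. v \<in> V \<Longrightarrow> vertex_sum E L v = r" and le: "L e \<le> k"
        using e_in by (auto simp: magic_labeling_def magic_labeling_of_index_def)
      have "vertex_sum E (\<lambda>i. if i \<in> E then real (L i) else 0) v = real r" if "v \<in> V" for v
      proof -
        have "vertex_sum E (\<lambda>i. if i \<in> E then real (L i) else 0) v = vertex_sum E (\<lambda>i. real (L i)) v"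
          by (rule vertex_sum_cong) simp
        then show ?thesis using r[OF that] by (simp add: vertex_sum_of_nat)
      qed
      then have "(\<lambda>i. if i \<in> E then real (L i) else 0) \<in> magic_cone V E"
        by (auto simp: magic_cone_def)
      then show "(\<lambda>i. if i \<in> E then real (L i) else 0) \<in> pts (\<lambda>_. 0) {} (real k)"
        using le by (simp add: pts_def)
    qed
    show "(\<lambda>x. restrict (\<lambda>i. nat \<lfloor>x i\<rfloor>) E) ` pts (\<lambda>_. 0) {} (real k)
        \<subseteq> {L. magic_labeling V E L \<and> (\<forall>e\<in>E. L e \<le> k)}"
    proof (rule image_subsetI)
      fix x assume x: "x \<in> pts (\<lambda>_. 0) {} (real k)"
      then have xW: "x \<in> magic_cone V E" "\<forall>i. 0 \<le> x i" "x e \<le> k" by (simp_all add: pts_def)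
      obtain r where r: "\<And>v. v \<in> V \<Longrightarrow> vertex_sum E x v = r"
        using xW(1) by (auto simp: magic_cone_def)
      let ?L = "restrict (\<lambda>i. nat \<lfloor>x i\<rfloor>) E"
      \<comment> \<open>At any vertex the real index is a sum of natural numbers, so its floor is
        the index of \<open>?L\<close>.\<close>
      have "vertex_sum E ?L v = nat \<lfloor>r\<rfloor>" if "v \<in> V" for v
      proof -
        have "real (vertex_sum E ?L v) = vertex_sum E x v"
          unfolding vertex_sum_of_nat [symmetric] using floor[OF x] by (intro vertex_sum_cong) simp
        then show ?thesis using r[OF that] by (metis floor_of_nat nat_int)
      qed
      moreover have "?L i \<le> k" if "i \<in> E" for i
      proof -
        have "real (?L i) \<le> real k" using le_peak[OF xW(1,2), of i] xW(3) floor[OF x, of i] that by simp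
        then show ?thesis by simp
      qed
      ultimately show "?L \<in> {L. magic_labeling V E L \<and> (\<forall>e\<in>E. L e \<le> k)}"
        by (auto simp: magic_labeling_def magic_labeling_of_index_def)
    qed
  qed
  then show ?thesis unfolding magic_count_def by (rule bij_betw_same_card)
qed

section \<open>Quasipolynomiality in general, polynomiality for bipartite graphs\<close>

theorem proposition5p1:
  fixes V :: "'v set" and E :: "'v set set" and e :: "'v set"
  assumes "graph V E"
    and "e \<in> E"
    and "\<And>L. magic_labeling_of_index V E 2 L \<Longrightarrow> L e = Max (L ` E)"
  shows "quasipolynomial (\<lambda>k. of_nat (magic_count V E k)) \<and>
         (\<exists>s\<le>2. has_quasiperiod (\<lambda>k. of_nat (magic_count V E k)) s) \<and>
         (bipartite V E \<longrightarrow> polynomial_function (\<lambda>k. of_nat (magic_count V E k)))"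
proof -
  have count: "polynomial_on_progressions d (\<lambda>k. of_nat (card (peaked_cone.pts (magic_cone V E) e (\<lambda>_. 0) {} k)))"
    if "peaked_cone E (magic_cone V E) e d" for d
    using peaked_cone.polynomial_pts[OF that] by simp
  have "peaked_cone E (magic_cone V E) e 2"
  proof (rule peaked_magic_cone[OF assms disjI2[OF refl]])
    show "\<exists>F :: 'v set \<Rightarrow> nat. (\<forall>v\<in>V. vertex_sum E F v = 2) \<and> (\<forall>\<epsilon>. F \<epsilon> \<noteq> 0 \<longrightarrow> \<epsilon> \<in> E \<and> x \<epsilon> \<noteq> 0)"
      if "\<And>\<epsilon>. \<epsilon> \<in> E \<Longrightarrow> 0 \<le> x \<epsilon>" "\<And>v. v \<in> V \<Longrightarrow> vertex_sum E x v = r" "r > 0"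
      for x :: "'v set \<Rightarrow> real" and r
      using index_two_labeling_in_support[OF assms(1) that] by metis
  qed
  note two = count[OF this] magic_count_eq_card_pts[OF this]
  have "\<exists>q. \<forall>n. of_nat (magic_count V E (r + 2 * n)) = poly q (of_nat n :: complex)" if r: "r < 2" for r
  proof -
    obtain q where q: "\<And>n. of_nat (card (peaked_cone.pts (magic_cone V E) e (\<lambda>_. 0) {}
        (real r + real 2 * real n))) = poly q (of_nat n :: complex)"
      using two(1)[unfolded polynomial_on_progressions_def, THEN spec, THEN mp, of "real r"] r
      by auto
    have "real (r + 2 * n) = real r + real 2 * real n" for n by simp
    with q have "of_nat (magic_count V E (r + 2 * n)) = poly q (of_nat n)" for n
      unfolding two(2) by metis
    then show ?thesis by blast
  qed
  then obtain q where q: "\<And>r n. r < 2 \<Longrightarrow>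
      of_nat (magic_count V E (r + 2 * n)) = poly (q r) (of_nat n :: complex)"
    by metis
  \<comment> \<open>\<open>q r\<close> is a polynomial in \<open>n\<close> for
    \<open>t = r + 2 * n\<close>, so \<open>n\<close> is replaced by \<open>t / 2\<close> or
    \<open>(t - 1) / 2\<close>. The even class is numbered 2, since residues run through
    \<open>{1..2}\<close>, but uses \<open>q 0\<close>.\<close>
  define \<phi> where "\<phi> r = (if r = 2 then pcompose (q 0) [:0, 1/2:] else pcompose (q 1) [:-1/2, 1/2:])"
    for r :: nat
  have "of_nat (magic_count V E t) = poly (\<phi> r) (of_nat t)" if "r \<in> {1..2}" "[t = r] (mod 2)" for r t
  proof (cases "r = 2")
    case True
    then have "even t" using that(2) by (simp add: cong_def even_iff_mod_2_eq_zero)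
    then obtain n where "t = 0 + 2 * n" by auto
    then show ?thesis using q[of 0 n] True by (simp add: \<phi>_def poly_pcompose)
  next
    case False
    then have "r = 1" using that(1) by auto
    then have "odd t" using that(2) by (simp add: cong_def odd_iff_mod_2_eq_one)
    then obtain n where "t = 1 + 2 * n" by (auto elim!: oddE)
    then show ?thesis using q[of 1 n] False by (simp add: \<phi>_def poly_pcompose add_divide_distrib)
  qed
  then have period: "has_quasiperiod (\<lambda>k. of_nat (magic_count V E k)) 2"
    unfolding has_quasiperiod_def by auto
  have "polynomial_function (\<lambda>k. of_nat (magic_count V E k))" if bip: "bipartite V E"
  proof -
    have "peaked_cone E (magic_cone V E) e 1"
    proof (rule peaked_magic_cone[OF assms disjI1[OF refl]])
      show "\<exists>F :: 'v set \<Rightarrow> nat. (\<forall>v\<in>V. vertex_sum E F v = 1) \<and> (\<forall>\<epsilon>. F \<epsilon> \<noteq> 0 \<longrightarrow> \<epsilon> \<in> E \<and> x \<epsilon> \<noteq> 0)"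
        if "\<And>\<epsilon>. \<epsilon> \<in> E \<Longrightarrow> 0 \<le> x \<epsilon>" "\<And>v. v \<in> V \<Longrightarrow> vertex_sum E x v = r" "r > 0"
        for x :: "'v set \<Rightarrow> real" and r
        using index_one_labeling_in_support[OF assms(1) that bip] by metis
    qed
    note one = count[OF this] magic_count_eq_card_pts[OF this]
    \<comment> \<open>With step 1 the progression starting at 0 runs through all natural
      numbers.\<close>
    have "\<exists>q. \<forall>n. of_nat (card (peaked_cone.pts (magic_cone V E) e (\<lambda>_. 0) {}
        (0 + real 1 * real n))) = poly q (of_nat n :: complex)"
      using one(1)[unfolded polynomial_on_progressions_def, THEN spec, THEN mp, of 0] by simp
    then show ?thesis
      unfolding polynomial_function_def one(2) by simp
  qed
  with period show ?thesis unfolding quasipolynomial_def by blast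
qed

end
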